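(* Let $\mathfrak{h}=\mathbb{Q}\langle x,y\rangle$, $\mathfrak{h}^0=\mathbb{Q}+x\mathfrak{h}y$, and let $\widehat{\mathfrak{h}}=\mathbb{Q}\langle\langle x,y\rangle\rangle$ and $\widehat{\mathfrak{h}^0}$ be the completions (with respect to degree). Let $\tau$ be the anti-automorphism of $\mathfrak{h}$ (extended to the completion) with $\tau(x)=y$, $\tau(y)=x$. For $n\ge1$ let $\partial_n$ be the $\mathbb{Q}$-linear derivation of $\mathfrak{h}$ with $\partial_n(x)=-\partial_n(y)=x(x+y)^{n-1}y$, let $\Theta=\exp\left(\sum_{n\ge1}\frac{\partial_n}{n}\right)\in\mathbb{Q}[[\partial_1,\partial_2,\ldots]]$ (grading $\deg\partial_n=n$, products meaning composition), and let $\theta_l$ be the homogeneous degree-$l$ part of $\Theta$ (so $\theta_1=\partial_1$, $\theta_2=\frac12(\partial_2+\partial_1^2)$, ...), all extended naturally to $\widehat{\mathfrak{h}}$. Write $\frac{1}{1-x}=\sum_{k\ge0}x^k$, $\frac{1}{1-y}=\sum_{k\ge0}y^k$. Then the following identities hold in $\widehat{\mathfrak{h}^0}$, where empty sums are $0$ and $1$ in $\Theta-1$ denotes the identity map: (i) For every positive integer $m$, $$(1-\tau)\left(x^m y\frac{1}{1-x}y\right)=(\Theta-1)\left(x^m y\left(1-\frac{1}{1-x}y\right)\right)-\sum_{i=1}^{m-1}\theta_i\left(x^{m-i}y+\left(x\frac{1}{1-y}\right)^{m-i}xy-\left(x\frac{1}{1-y}\right)^{m-i-1}xy\right).$$ (ii)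 For every positive integer $n$, $$(1-\tau)\left(xy\left(\frac{1}{1-x}y\right)^{n-1}\right)=(\Theta-1)\left(x\frac{1-x^{n-1}}{1-x}y\left(1-\frac{1}{1-x}y\right)\right)-\sum_{l=1}^{n-2}\theta_l\left(x\frac{1-x^{n-l-1}}{1-x}y\left(1-\frac{1}{1-x}y\right)\right).$$
   Context: Here $\mathfrak{h}=\mathbb{Q}\langle x,y\rangle$ is the noncommutative polynomial ring in $x,y$; derivations satisfy the Leibniz rule $\partial_n(vw)=\partial_n(v)w+v\partial_n(w)$. It is known that $\partial_n(\mathfrak{h})\subset\mathfrak{h}^0$, that $\partial_n$ raises degree by $n$ on words, and that the $\partial_n$ commute pairwise, so $\Theta$ and $\theta_l$ are well defined. $x\frac{1-x^{n-1}}{1-x}$ denotes $x+x^2+\cdots+x^{n-1}$. *)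

theory Defs
  imports Complex_Main "HOL-Library.Groups_Big_Fun"
begin

section \<open>The ring of noncommutative formal power series in two letters\<close>

datatype letter = Lx | Ly

typedef ncs = "UNIV :: (letter list \<Rightarrow> rat) set"
  morphisms coeff Abs_ncs ..

setup_lifting type_definition_ncs

lemma ncs_eqI: "(\<And>u. coeff f u = coeff g u) \<Longrightarrow> f = g"
  by transfer auto

instantiation ncs :: ab_group_add
begin

lift_definition zero_ncs :: ncs is "\<lambda>u. 0" .
lift_definition plus_ncs :: "ncs \<Rightarrow> ncs \<Rightarrow> ncs" is "\<lambda>f g u. f u + g u" .
lift_definition minus_ncs :: "ncs \<Rightarrow> ncs \<Rightarrow> ncs" is "\<lambda>f g u. f u - g u" .
lift_definition uminus_ncs :: "ncs \<Rightarrow> ncs" is "\<lambda>f u. - f u" .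

instance
  by standard (transfer; simp add: fun_eq_iff)+

end

lemma cauchy_assoc:
  fixes f g h :: "letter list \<Rightarrow> rat"
  shows "(\<Sum>i\<le>length u. (\<Sum>j\<le>length (take i u). f (take j (take i u)) * g (drop j (take i u))) * h (drop i u))
       = (\<Sum>i\<le>length u. f (take i u) * (\<Sum>j\<le>length (drop i u). g (take j (drop i u)) * h (drop j (drop i u))))"
    (is "?L = ?R")
proof -
  let ?t = "\<lambda>j k. f (take j u) * g (take k (drop j u)) * h (drop (j + k) u)"
  have "?L = (\<Sum>i\<le>length u. \<Sum>j\<le>i. ?t j (i - j))"
    by (intro sum.cong refl) (simp add: sum_distrib_right drop_take min_def)
  also have "\<dots> = (\<Sum>(i, j)\<in>Sigma {..length u} (\<lambda>i. {..i}). ?t j (i - j))"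
    by (rule sum.Sigma) auto
  also have "\<dots> = (\<Sum>(j, k)\<in>Sigma {..length u} (\<lambda>j. {..length u - j}). ?t j k)"
    by (rule sum.reindex_bij_witness [of _ "\<lambda>(j, k). (j + k, j)" "\<lambda>(i, j). (j, i - j)"])
       auto
  also have "\<dots> = (\<Sum>j\<le>length u. \<Sum>k\<le>length u - j. ?t j k)"
    by (rule sum.Sigma [symmetric]) auto
  also have "\<dots> = ?R"
    by (intro sum.cong refl) (simp add: sum_distrib_left mult.assoc add.commute)
  finally show ?thesis .
qed

instantiation ncs :: ring_1
begin

lift_definition one_ncs :: ncs is "\<lambda>u. if u = [] then 1 else 0" .
lift_definition times_ncs :: "ncs \<Rightarrow> ncs \<Rightarrow> ncs" is
  "\<lambda>f g u. \<Sum>i\<le>length u. f (take i u) * g (drop i u)" .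

instance
proof
  fix f g h :: ncs
  show "f * g * h = f * (g * h)"
    by transfer (rule ext, rule cauchy_assoc)
  show "1 * f = f"
  proof (transfer, rule ext)
    fix f :: "letter list \<Rightarrow> rat" and u
    have "(\<Sum>i\<le>length u. (if take i u = [] then 1 else 0) * f (drop i u)) =
        (\<Sum>i\<in>{0}. (if take i u = [] then 1 else 0) * f (drop i u))"
      by (rule sum.mono_neutral_right) auto
    then show "(\<Sum>i\<le>length u. (if take i u = [] then 1 else 0) * f (drop i u)) = f u"
      by simp
  qed
  show "f * 1 = f"
  proof (transfer, rule ext)
    fix f :: "letter list \<Rightarrow> rat" and u
    have "(\<Sum>i\<le>length u. f (take i u) * (if drop i u = [] then 1 else 0)) =
        (\<Sum>i\<in>{length u}. f (take i u) * (if drop i u = [] then 1 else 0))"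
      by (rule sum.mono_neutral_right) auto
    then show "(\<Sum>i\<le>length u. f (take i u) * (if drop i u = [] then 1 else 0)) = f u"
      by simp
  qed
  show "(f + g) * h = f * h + g * h" "f * (g + h) = f * g + f * h"
    by (transfer; simp add: fun_eq_iff algebra_simps sum.distrib)+
  show "(0::ncs) \<noteq> 1"
    by transfer (auto simp: fun_eq_iff)
qed

end

lift_definition smult :: "rat \<Rightarrow> ncs \<Rightarrow> ncs" is "\<lambda>c f u. c * f u" .

lift_definition word :: "letter list \<Rightarrow> ncs" is "\<lambda>w u. if u = w then 1 else 0" .

definition X :: ncs where "X = word [Lx]"
definition Y :: ncs where "Y = word [Ly]"

text \<open>Coefficientwise infinite sums. The value is meaningful only for families satisfying
  \<open>nc_summable\<close>; see \<open>geom_summable\<close>, \<open>pder_summable\<close>, \<open>theta_summable\<close>, \<open>Theta_summable\<close>.\<close>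

definition nc_summable :: "('i \<Rightarrow> ncs) \<Rightarrow> bool" where
  "nc_summable F \<longleftrightarrow> (\<forall>u. finite {i. coeff (F i) u \<noteq> 0})"

lift_definition nc_sum :: "('i \<Rightarrow> ncs) \<Rightarrow> ncs" is "\<lambda>F u. Sum_any (\<lambda>i. F i u)" .

text \<open>\<open>geom f\<close> is \<open>1/(1 - f)\<close>, for \<open>f\<close> without constant term.\<close>

definition geom :: "ncs \<Rightarrow> ncs" where
  "geom f = nc_sum (\<lambda>k::nat. f ^ k)"

section \<open>Polynomials and completions\<close>

definition nc_poly :: "ncs set" where
  "nc_poly = {f. finite {u. coeff f u \<noteq> 0}}"

definition H0 :: "ncs set" where
  "H0 = {smult c 1 + X * g * Y | c g. g \<in> nc_poly}"

lift_definition hom_part :: "nat \<Rightarrow> ncs \<Rightarrow> ncs" is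
  "\<lambda>n f u. if length u = n then f u else 0" .

text \<open>Completion with respect to degree of a graded subspace of the polynomial ring, realised
  inside the power series.\<close>

definition completion :: "ncs set \<Rightarrow> ncs set" where
  "completion S = {f. \<forall>n. hom_part n f \<in> S}"

section \<open>The anti-automorphism\<close>

fun swap_letter :: "letter \<Rightarrow> letter" where
  "swap_letter Lx = Ly"
| "swap_letter Ly = Lx"

lift_definition tau :: "ncs \<Rightarrow> ncs" is "\<lambda>f u. f (map swap_letter (rev u))" .

section \<open>The derivations\<close>

text \<open>Only \<open>n \<ge> 1\<close> is meaningful in this section.\<close>

fun pder_letter :: "nat \<Rightarrow> letter \<Rightarrow> ncs" where
  "pder_letter n Lx = X * (X + Y) ^ (n - 1) * Y"
| "pder_letter n Ly = - (X * (X + Y) ^ (n - 1) * Y)"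

fun pder_word :: "nat \<Rightarrow> letter list \<Rightarrow> ncs" where
  "pder_word n [] = 0"
| "pder_word n (a # w) = pder_letter n a * word w + word [a] * pder_word n w"

definition pder :: "nat \<Rightarrow> ncs \<Rightarrow> ncs" where
  "pder n f = nc_sum (\<lambda>w. smult (coeff f w) (pder_word n w))"

section \<open>The exponential\<close>

text \<open>An element of the degree-completed algebra of operators is given by the family of its
  homogeneous parts; the product is the Cauchy product with respect to composition.\<close>

type_synonym graded_op = "nat \<Rightarrow> ncs \<Rightarrow> ncs"

definition gop_one :: graded_op where
  "gop_one l f = (if l = 0 then f else 0)"

definition gop_mult :: "graded_op \<Rightarrow> graded_op \<Rightarrow> graded_op" where
  "gop_mult A B l f = (\<Sum>i\<le>l. A i (B (l - i) f))"

fun gop_power :: "graded_op \<Rightarrow> nat \<Rightarrow> graded_op" where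
  "gop_power A 0 = gop_one"
| "gop_power A (Suc k) = gop_mult A (gop_power A k)"

definition gop_exp :: "graded_op \<Rightarrow> graded_op" where
  "gop_exp A l f = nc_sum (\<lambda>k. smult (1 / fact k) (gop_power A k l f))"

definition log_theta :: graded_op where
  "log_theta n f = (if n = 0 then 0 else smult (1 / of_nat n) (pder n f))"

definition theta :: graded_op where
  "theta = gop_exp log_theta"

definition Theta :: "ncs \<Rightarrow> ncs" where
  "Theta f = nc_sum (\<lambda>l. theta l f)"

section \<open>Consistency of the definitions\<close>

lemmas coeff_simps [simp] =
  zero_ncs.rep_eq plus_ncs.rep_eq minus_ncs.rep_eq uminus_ncs.rep_eq one_ncs.rep_eq
  smult.rep_eq word.rep_eq hom_part.rep_eq tau.rep_eq

lemma coeff_nc_sum: "coeff (nc_sum F) u = Sum_any (\<lambda>i. coeff (F i) u)"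
  by transfer simp

lemma coeff_nc_sum_finite:
  assumes "finite A" "\<And>i. coeff (F i) u \<noteq> 0 \<Longrightarrow> i \<in> A"
  shows "coeff (nc_sum F) u = (\<Sum>i\<in>A. coeff (F i) u)"
  unfolding coeff_nc_sum by (rule Sum_any.expand_superset) (use assms in auto)

lemma coeff_sum: "coeff (\<Sum>i\<in>A. F i) u = (\<Sum>i\<in>A. coeff (F i) u)"
  by (induction A rule: infinite_finite_induct) auto

lemma word_Nil: "word [] = 1"
  by (rule ncs_eqI) simp

lemma word_append: "word v * word w = word (v @ w)"
proof (rule ncs_eqI)
  fix u :: "letter list"
  have "coeff (word v * word w) u =
      (\<Sum>i\<le>length u. if take i u = v \<and> drop i u = w then 1 else 0)"
    unfolding times_ncs.rep_eq by (auto intro!: sum.cong)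
  also have "\<dots> = (\<Sum>i\<in>{i. i \<le> length u \<and> take i u = v \<and> drop i u = w}. 1)"
    by (rule sum.mono_neutral_cong_right) auto
  also have "{i. i \<le> length u \<and> take i u = v \<and> drop i u = w} =
      (if u = v @ w then {length v} else {})"
    by (auto simp: min_def append_eq_conv_conj)
  finally show "coeff (word v * word w) u = coeff (word (v @ w)) u" by simp
qed

text \<open>\<open>order_ge f n\<close>: all terms of \<open>f\<close> have degree at least \<open>n\<close>.\<close>

definition order_ge :: "ncs \<Rightarrow> nat \<Rightarrow> bool" where
  "order_ge f n \<longleftrightarrow> (\<forall>u. length u < n \<longrightarrow> coeff f u = 0)"

definition homogeneous :: "ncs \<Rightarrow> nat \<Rightarrow> bool" where
  "homogeneous f n \<longleftrightarrow> (\<forall>u. length u \<noteq> n \<longrightarrow> coeff f u = 0)"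

lemma order_ge_0 [simp]: "order_ge f 0" "order_ge 0 n"
  by (auto simp: order_ge_def)

lemma order_ge_mult: "order_ge f m \<Longrightarrow> order_ge g n \<Longrightarrow> order_ge (f * g) (m + n)"
  unfolding order_ge_def times_ncs.rep_eq
proof (intro allI impI sum.neutral ballI)
  fix u :: "letter list" and i :: nat
  assume *: "\<forall>u. length u < m \<longrightarrow> coeff f u = 0" "\<forall>u. length u < n \<longrightarrow> coeff g u = 0"
    and u: "length u < m + n" and "i \<in> {..length u}"
  then have "length (take i u) < m \<or> length (drop i u) < n" by auto
  with * show "coeff f (take i u) * coeff g (drop i u) = 0" by auto
qed

lemma order_ge_power: "order_ge f 1 \<Longrightarrow> order_ge (f ^ k) k"
  by (induction k) (use order_ge_mult [of f 1] in auto)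

lemma homogeneous_mult: "homogeneous f m \<Longrightarrow> homogeneous g n \<Longrightarrow> homogeneous (f * g) (m + n)"
  unfolding homogeneous_def times_ncs.rep_eq
proof (intro allI impI sum.neutral ballI)
  fix u :: "letter list" and i :: nat
  assume *: "\<forall>u. length u \<noteq> m \<longrightarrow> coeff f u = 0" "\<forall>u. length u \<noteq> n \<longrightarrow> coeff g u = 0"
    and u: "length u \<noteq> m + n" and "i \<in> {..length u}"
  then have "length (take i u) \<noteq> m \<or> length (drop i u) \<noteq> n" by auto
  with * show "coeff f (take i u) * coeff g (drop i u) = 0" by auto
qed

lemma homogeneous_add: "homogeneous f n \<Longrightarrow> homogeneous g n \<Longrightarrow> homogeneous (f + g) n"
  by (auto simp: homogeneous_def)

lemma homogeneous_uminus: "homogeneous f n \<Longrightarrow> homogeneous (- f) n"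
  by (auto simp: homogeneous_def)

lemma homogeneous_word: "homogeneous (word w) (length w)"
  by (auto simp: homogeneous_def)

lemma homogeneous_X: "homogeneous X 1" and homogeneous_Y: "homogeneous Y 1"
  using homogeneous_word [of "[_]"] by (auto simp: X_def Y_def)

lemma homogeneous_power: "homogeneous f 1 \<Longrightarrow> homogeneous (f ^ k) k"
  by (induction k) (use homogeneous_mult [of f 1] in \<open>auto simp: homogeneous_def\<close>)

lemma nc_summable_order:
  assumes "\<And>k. order_ge (F k) k"
  shows "nc_summable F"
  unfolding nc_summable_def
proof
  fix u :: "letter list"
  show "finite {i. coeff (F i) u \<noteq> 0}"
    by (rule finite_subset [of _ "{..length u}"])
       (use assms in \<open>auto simp: order_ge_def intro!: leI\<close>)
qed

lemma geom_summable: "order_ge f 1 \<Longrightarrow> nc_summable (\<lambda>k. f ^ k)"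
  by (intro nc_summable_order order_ge_power)

lemma one_minus_mult_sum_power:
  fixes f :: ncs
  shows "(1 - f) * (\<Sum>k<n. f ^ k) = 1 - f ^ n"
  by (induction n) (simp_all add: distrib_left left_diff_distrib)

lemma geom_inverse:
  assumes "order_ge f 1"
  shows "(1 - f) * geom f = 1"
proof (rule ncs_eqI)
  fix u :: "letter list"
  let ?N = "Suc (length u)"
  let ?P = "\<Sum>k<?N. f ^ k"
  have "coeff (geom f) v = coeff ?P v" if "length v \<le> length u" for v
    unfolding geom_def coeff_sum
  proof (rule coeff_nc_sum_finite)
    fix k assume "coeff (f ^ k) v \<noteq> 0"
    with order_ge_power [OF assms, of k] have "\<not> length v < k"
      by (auto simp: order_ge_def)
    with that show "k \<in> {..<?N}" by simp
  qed simp
  then have "coeff ((1 - f) * geom f) u = coeff ((1 - f) * ?P) u"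
    unfolding times_ncs.rep_eq by (intro sum.cong) auto
  also have "(1 - f) * ?P = 1 - f ^ ?N"
    by (rule one_minus_mult_sum_power)
  also have "coeff \<dots> u = coeff 1 u"
    using order_ge_power [OF assms, of ?N] by (simp add: order_ge_def)
  finally show "coeff ((1 - f) * geom f) u = coeff 1 u" .
qed

lemma order_ge_X: "order_ge X 1" and order_ge_Y: "order_ge Y 1"
  by (auto simp: X_def Y_def order_ge_def)

lemma finite_words_length_le: "finite {w :: letter list. length w \<le> n}"
proof -
  have "finite {Lx, Ly}" by simp
  from finite_lists_length_le [OF this, of n]
  have "finite {w. set w \<subseteq> {Lx, Ly} \<and> length w \<le> n}" .
  moreover have "set w \<subseteq> {Lx, Ly}" for w
    using letter.exhaust by blast
  ultimately show ?thesis by simp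
qed

lemma completion_nc_poly: "completion nc_poly = UNIV"
proof -
  have "finite {u. coeff (hom_part n f) u \<noteq> 0}" for n f
    by (rule finite_subset [OF _ finite_words_length_le [of n]]) (auto split: if_splits)
  then show ?thesis by (auto simp: completion_def nc_poly_def)
qed

lemma swap_letter_swap [simp]: "swap_letter (swap_letter a) = a"
  by (cases a) auto

lemma tau_tau: "tau (tau f) = f"
  by (rule ncs_eqI) (simp add: rev_map o_def)

lemma tau_add: "tau (f + g) = tau f + tau g"
  by (rule ncs_eqI) simp

lemma tau_mult: "tau (f * g) = tau g * tau f"
proof (rule ncs_eqI)
  fix u :: "letter list"
  show "coeff (tau (f * g)) u = coeff (tau g * tau f) u"
    unfolding times_ncs.rep_eq tau.rep_eq
    by (rule sum.reindex_bij_witness [of _ "\<lambda>i. length u - i" "\<lambda>i. length u - i"])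
       (auto simp: rev_take rev_drop take_map drop_map mult.commute)
qed

lemma tau_word: "tau (word w) = word (map swap_letter (rev w))"
  by (rule ncs_eqI) (auto simp: rev_map o_def)

lemma tau_X: "tau X = Y" and tau_Y: "tau Y = X" and tau_1: "tau 1 = 1"
  by (auto simp: X_def Y_def tau_word tau_word [of "[]", simplified word_Nil] word_Nil)

text \<open>\<open>pder n\<close> is the linear, degreewise continuous extension of \<open>pder_word n\<close>, it raises degree
  by \<open>n\<close>, and it satisfies the Leibniz rule.\<close>

lemma homogeneous_pder_letter:
  assumes "n \<ge> 1" shows "homogeneous (pder_letter n a) (Suc n)"
proof -
  have "homogeneous (X * (X + Y) ^ (n - 1) * Y) (1 + (n - 1) + 1)"
    by (intro homogeneous_mult homogeneous_power homogeneous_add homogeneous_X homogeneous_Y)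
  then have "homogeneous (X * (X + Y) ^ (n - 1) * Y) (Suc n)" using assms by simp
  then show ?thesis by (cases a) (simp_all add: homogeneous_uminus)
qed

lemma homogeneous_pder_word:
  assumes "n \<ge> 1" shows "homogeneous (pder_word n w) (length w + n)"
proof (induction w)
  case (Cons a w)
  have "homogeneous (pder_letter n a * word w) (Suc n + length w)"
       "homogeneous (word [a] * pder_word n w) (length [a] + (length w + n))"
    by (intro homogeneous_mult homogeneous_pder_letter homogeneous_word assms Cons.IH)+
  then show ?case by (auto intro!: homogeneous_add simp: add_ac)
qed (auto simp: homogeneous_def)

lemma pder_summable:
  assumes "n \<ge> 1" shows "nc_summable (\<lambda>w. smult (coeff f w) (pder_word n w))"
  unfolding nc_summable_def
proof
  fix u :: "letter list"
  show "finite {w. coeff (smult (coeff f w) (pder_word n w)) u \<noteq> 0}"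
    by (rule finite_subset [OF _ finite_words_length_le [of "length u"]])
       (use homogeneous_pder_word [OF assms] in \<open>force simp: homogeneous_def\<close>)
qed

lemma coeff_pder:
  assumes "n \<ge> 1" "length u \<le> N"
  shows "coeff (pder n f) u = (\<Sum>w | length w \<le> N. coeff f w * coeff (pder_word n w) u)"
proof -
  have "coeff (pder n f) u =
      (\<Sum>w | length w \<le> N. coeff (smult (coeff f w) (pder_word n w)) u)"
    unfolding pder_def
  proof (rule coeff_nc_sum_finite [OF finite_words_length_le])
    fix w assume "coeff (smult (coeff f w) (pder_word n w)) u \<noteq> 0"
    then have "length u = length w + n"
      using homogeneous_pder_word [OF assms(1), of w] by (auto simp: homogeneous_def)
    with assms show "w \<in> {w. length w \<le> N}" by simp
  qed
  then show ?thesis by simp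
qed

lemma pder_add: "n \<ge> 1 \<Longrightarrow> pder n (f + g) = pder n f + pder n g"
  by (rule ncs_eqI) (simp add: coeff_pder [OF _ order_refl] algebra_simps sum.distrib)

lemma pder_smult: "n \<ge> 1 \<Longrightarrow> pder n (smult c f) = smult c (pder n f)"
  by (rule ncs_eqI) (simp add: coeff_pder [OF _ order_refl] algebra_simps sum_distrib_left)

lemma pder_of_word: "n \<ge> 1 \<Longrightarrow> pder n (word w) = pder_word n w"
proof (rule ncs_eqI)
  fix u :: "letter list" assume n: "n \<ge> 1"
  have "coeff (pder n (word w)) u =
      (\<Sum>v | length v \<le> max (length u) (length w). coeff (word w) v * coeff (pder_word n v) u)"
    by (rule coeff_pder) (use n in auto)
  also have "\<dots> = (\<Sum>v\<in>{w}. coeff (word w) v * coeff (pder_word n v) u)"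
    by (rule sum.mono_neutral_right) (auto simp: finite_words_length_le)
  finally show "coeff (pder n (word w)) u = coeff (pder_word n w) u" by simp
qed

lemma pder_X: "n \<ge> 1 \<Longrightarrow> pder n X = X * (X + Y) ^ (n - 1) * Y"
  and pder_Y: "n \<ge> 1 \<Longrightarrow> pder n Y = - (X * (X + Y) ^ (n - 1) * Y)"
  by (simp_all add: pder_of_word X_def Y_def word_Nil)

lemma pder_word_append:
  "pder_word n (v @ w) = pder_word n v * word w + word v * pder_word n w"
proof (induction v)
  case (Cons a v)
  have "word (v @ w) = word v * word w" "word (a # v) = word [a] * word v"
    by (simp_all add: word_append)
  then show ?case by (simp add: Cons.IH algebra_simps)
qed (simp add: word_Nil)

lemma smult_mult_left: "smult c f * g = smult c (f * g)"
  by (rule ncs_eqI) (simp add: times_ncs.rep_eq sum_distrib_left mult.assoc)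

lemma smult_mult_right: "f * smult c g = smult c (f * g)"
  by (rule ncs_eqI) (simp add: times_ncs.rep_eq sum_distrib_left algebra_simps)

lemma smult_add_right: "smult c (f + g) = smult c f + smult c g"
  by (rule ncs_eqI) (simp add: algebra_simps)

lemma smult_smult: "smult c (smult d f) = smult (c * d) f"
  by (rule ncs_eqI) simp

lemma smult_0_right [simp]: "smult c 0 = 0" and smult_0_left [simp]: "smult 0 f = 0"
  and smult_1_left [simp]: "smult 1 f = f"
  by (rule ncs_eqI, simp)+

lemma smult_sum_right: "smult c (\<Sum>i\<in>A. F i) = (\<Sum>i\<in>A. smult c (F i))"
  by (induction A rule: infinite_finite_induct) (auto simp: smult_add_right)

lemma pder_0 [simp]: "pder n 0 = 0"
  unfolding pder_def by (rule ncs_eqI) (simp add: coeff_nc_sum)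

lemma pder_sum: "n \<ge> 1 \<Longrightarrow> pder n (\<Sum>i\<in>A. F i) = (\<Sum>i\<in>A. pder n (F i))"
  by (induction A rule: infinite_finite_induct) (auto simp: pder_add)

definition truncate :: "nat \<Rightarrow> ncs \<Rightarrow> ncs" where
  "truncate N f = (\<Sum>w | length w \<le> N. smult (coeff f w) (word w))"

lemma coeff_truncate: "length u \<le> N \<Longrightarrow> coeff (truncate N f) u = coeff f u"
proof -
  assume u: "length u \<le> N"
  have "coeff (truncate N f) u = (\<Sum>w | length w \<le> N. if u = w then coeff f w else 0)"
    unfolding truncate_def coeff_sum by (intro sum.cong) auto
  also have "\<dots> = coeff f u"
    using u by (simp add: sum.delta' finite_words_length_le)
  finally show ?thesis .
qed

lemma coeff_mult_cong:
  assumes "\<And>v. length v \<le> length u \<Longrightarrow> coeff f v = coeff f' v"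
    and "\<And>v. length v \<le> length u \<Longrightarrow> coeff g v = coeff g' v"
  shows "coeff (f * g) u = coeff (f' * g') u"
  unfolding times_ncs.rep_eq by (intro sum.cong) (auto simp: assms)

lemma coeff_pder_cong:
  assumes "n \<ge> 1" "\<And>v. length v \<le> length u \<Longrightarrow> coeff f v = coeff f' v"
  shows "coeff (pder n f) u = coeff (pder n f') u"
  by (simp add: coeff_pder [OF assms(1) order_refl] assms(2))

lemma pder_mult_truncate:
  assumes "n \<ge> 1"
  shows "pder n (truncate N f * truncate N g) =
    pder n (truncate N f) * truncate N g + truncate N f * pder n (truncate N g)"
proof -
  have *: "pder n (smult c (word v) * smult d (word w)) =
      pder n (smult c (word v)) * smult d (word w) +
      smult c (word v) * pder n (smult d (word w))" for c d v w
    by (simp add: smult_mult_left smult_mult_right smult_smult smult_add_right word_append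
        pder_smult [OF assms] pder_of_word [OF assms] pder_word_append mult.commute)
  show ?thesis
    unfolding truncate_def sum_product
    by (simp only: pder_sum [OF assms] * sum.distrib sum_product)
qed

theorem pder_mult:
  assumes "n \<ge> 1"
  shows "pder n (f * g) = pder n f * g + f * pder n g"
proof (rule ncs_eqI)
  fix u :: "letter list"
  let ?t = "truncate (length u)"
  have t: "length v \<le> length u \<Longrightarrow> coeff (?t h) v = coeff h v" for v h
    by (rule coeff_truncate)
  have d: "length v \<le> length u \<Longrightarrow> coeff (pder n (?t h)) v = coeff (pder n h) v" for v h
    by (rule coeff_pder_cong [OF assms]) (simp add: t)
  have "coeff (pder n (f * g)) u = coeff (pder n (?t f * ?t g)) u"
    by (intro coeff_pder_cong [OF assms] coeff_mult_cong) (simp_all add: t)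
  also have "\<dots> = coeff (pder n (?t f) * ?t g) u + coeff (?t f * pder n (?t g)) u"
    by (simp add: pder_mult_truncate [OF assms])
  also have "coeff (pder n (?t f) * ?t g) u = coeff (pder n f * g) u"
    by (intro coeff_mult_cong) (simp_all add: t d)
  also have "coeff (?t f * pder n (?t g)) u = coeff (f * pder n g) u"
    by (intro coeff_mult_cong) (simp_all add: t d)
  finally show "coeff (pder n (f * g)) u = coeff (pder n f * g + f * pder n g) u" by simp
qed

lemma log_theta_0_right [simp]: "log_theta n 0 = 0"
  by (simp add: log_theta_def)

lemma gop_power_log_theta_eq_0: "l < k \<Longrightarrow> gop_power log_theta k l f = 0"
proof (induction k arbitrary: l)
  case (Suc k)
  have "log_theta i (gop_power log_theta k (l - i) f) = 0" if "i \<le> l" for i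
  proof (cases "i = 0")
    case False
    with that Suc.prems have "l - i < k" by auto
    then show ?thesis by (simp add: Suc.IH)
  qed (simp add: log_theta_def)
  then show ?case by (simp add: gop_mult_def)
qed simp

lemma theta_summable: "nc_summable (\<lambda>k. smult (1 / fact k) (gop_power log_theta k l f))"
  unfolding nc_summable_def
proof
  fix u :: "letter list"
  show "finite {k. coeff (smult (1 / fact k) (gop_power log_theta k l f)) u \<noteq> 0}"
    by (rule finite_subset [of _ "{..l}"])
       (auto simp: gop_power_log_theta_eq_0 intro!: leI)
qed

lemma theta_eq: "theta l f = (\<Sum>k\<le>l. smult (1 / fact k) (gop_power log_theta k l f))"
proof (rule ncs_eqI)
  fix u :: "letter list"
  have "coeff (theta l f) u =
      (\<Sum>k\<in>{..l}. coeff (smult (1 / fact k) (gop_power log_theta k l f)) u)"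
    unfolding theta_def gop_exp_def
    by (rule coeff_nc_sum_finite) (auto simp: gop_power_log_theta_eq_0 intro!: leI)
  then show "coeff (theta l f) u =
      coeff (\<Sum>k\<le>l. smult (1 / fact k) (gop_power log_theta k l f)) u"
    by (simp add: coeff_sum)
qed

lemma theta_0: "theta 0 f = f"
  by (simp add: theta_eq gop_one_def)

lemma theta_1: "theta 1 f = pder 1 f"
  by (simp add: theta_eq gop_one_def gop_mult_def log_theta_def)

lemma theta_2: "theta 2 f = smult (1 / 2) (pder 2 f + pder 1 (pder 1 f))"
proof -
  have 2: "{..2} = {0, 1, 2 :: nat}" "{..1} = {0, 1 :: nat}" by auto
  have "gop_power log_theta 0 2 f = 0"
    by (simp add: gop_one_def)
  moreover have "gop_power log_theta 1 2 f = smult (1 / 2) (pder 2 f)"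
    by (simp add: 2 gop_mult_def gop_one_def log_theta_def)
  moreover have "gop_power log_theta 2 2 f = pder 1 (pder 1 f)"
  proof -
    have "gop_power log_theta 2 = gop_mult log_theta (gop_mult log_theta gop_one)"
      by (simp add: numeral_2_eq_2)
    then show ?thesis
      by (simp add: 2 gop_mult_def gop_one_def log_theta_def)
  qed
  ultimately show ?thesis
    by (simp add: theta_eq 2 smult_add_right del: gop_power.simps)
qed

lemma order_ge_smult: "order_ge f m \<Longrightarrow> order_ge (smult c f) m"
  by (simp add: order_ge_def)

lemma order_ge_sum: "(\<And>i. i \<in> A \<Longrightarrow> order_ge (F i) m) \<Longrightarrow> order_ge (\<Sum>i\<in>A. F i) m"
  by (simp add: order_ge_def coeff_sum)

lemma order_ge_pder:
  assumes "n \<ge> 1" "order_ge f m"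
  shows "order_ge (pder n f) (m + n)"
  unfolding order_ge_def
proof (intro allI impI)
  fix u :: "letter list" assume u: "length u < m + n"
  have "coeff f w * coeff (pder_word n w) u = 0" for w
  proof (cases "length w < m")
    case False
    with u have "length u \<noteq> length w + n" by simp
    with homogeneous_pder_word [OF assms(1), of w] show ?thesis
      by (simp add: homogeneous_def)
  qed (use assms(2) in \<open>simp add: order_ge_def\<close>)
  then show "coeff (pder n f) u = 0"
    unfolding coeff_pder [OF assms(1) order_refl] by (intro sum.neutral) blast
qed

lemma order_ge_log_theta: "order_ge f m \<Longrightarrow> order_ge (log_theta l f) (m + l)"
  using order_ge_pder [of l f m] by (auto simp: log_theta_def intro: order_ge_smult)

lemma order_ge_gop_power: "order_ge (gop_power log_theta k l f) l"
proof (induction k arbitrary: l)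
  case (Suc k)
  have "order_ge (log_theta i (gop_power log_theta k (l - i) f)) l" if "i \<le> l" for i
    using order_ge_log_theta [OF Suc.IH [of "l - i"], of i] that by simp
  then show ?case by (auto simp: gop_mult_def intro: order_ge_sum)
qed (auto simp: gop_one_def)

lemma Theta_summable: "nc_summable (\<lambda>l. theta l f)"
  by (intro nc_summable_order)
     (simp add: theta_eq order_ge_sum order_ge_smult order_ge_gop_power)

end

theory Submission
  imports Defs "HOL-Computational_Algebra.Formal_Power_Series"
begin

text \<open>Put \<open>\<Theta>\<^sub>s = \<Sum> \<theta>\<^sub>l s\<^sup>l\<close> and \<open>z = x + y\<close>. As the \<open>\<partial>\<^sub>n\<close> commute, \<open>l \<theta>\<^sub>l = \<partial>\<^sub>1 \<theta>\<^bsub>l-1\<^esub> + \<dots> + \<partial>\<^sub>l \<theta>\<^sub>0\<close>.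
  This recursion shows that \<open>\<Theta>\<^sub>s\<close> is multiplicative with \<open>\<Theta>\<^sub>s z = z\<close> and
  \<open>\<Theta>\<^sub>s x = x/(1 - s y)\<close>, hence \<open>\<Theta>\<^sub>s y = (1 - s \<Theta>\<^sub>s x) y\<close>. The last formula makes
  \<open>\<Theta>\<^sub>s (1/(1 - s x) y h)\<close> collapse to \<open>y \<Theta>\<^sub>s h\<close>; comparing coefficients evaluates the sums over
  \<open>\<theta>\<^sub>i\<close> on the right-hand sides in closed form. The remaining terms follow from \<open>s = 1\<close>.\<close>

section \<open>The derivations commute\<close>

lemma pder_uminus: "n \<ge> 1 \<Longrightarrow> pder n (- f) = - pder n f"
  using pder_add [of n f "- f"] by (simp add: eq_neg_iff_add_eq_0 add.commute)

lemma pder_1: "n \<ge> 1 \<Longrightarrow> pder n 1 = 0"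
  using pder_of_word [of n "[]"] by (simp add: word_Nil)

lemma pder_XY_power: "n \<ge> 1 \<Longrightarrow> pder n ((X + Y) ^ k) = 0"
  by (induction k) (simp_all add: pder_1 pder_mult pder_add pder_X pder_Y)

text \<open>Powers of \<open>X + Y\<close> are killed, so only the outer letters of
  \<open>pder n X\<close> get differentiated. Replacing the inner \<open>X\<close> by
  \<open>(X + Y) - Y\<close> makes the result symmetric in \<open>m\<close> and \<open>n\<close>, so
  commutation on \<open>X\<close> can be read off.\<close>

lemma pder_pder_X:
  assumes "m \<ge> 1" "n \<ge> 1"
  shows "pder m (pder n X) =
    X * ((X + Y) ^ (m - 1) * Y * (X + Y) ^ (n - 1) + (X + Y) ^ (n - 1) * Y * (X + Y) ^ (m - 1)
      - (X + Y) ^ (m + n - 1)) * Y"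
proof -
  let ?Z = "X + Y"
  have "?Z ^ (m + n - 1) = ?Z ^ (n - 1) * ?Z * ?Z ^ (m - 1)"
    using assms by (metis add.commute diff_add_inverse2 le_add_diff_inverse2
        Nat.add_diff_assoc power_add power_one_right mult.assoc)
  then have "?Z ^ (n - 1) * X * ?Z ^ (m - 1) =
      ?Z ^ (m + n - 1) - ?Z ^ (n - 1) * Y * ?Z ^ (m - 1)"
    by (simp only: distrib_left distrib_right add_diff_cancel_right')
  moreover have "pder m (pder n X) =
      X * (?Z ^ (m - 1) * Y * ?Z ^ (n - 1) - ?Z ^ (n - 1) * X * ?Z ^ (m - 1)) * Y"
    using assms
    by (simp add: pder_mult pder_X pder_Y pder_XY_power left_diff_distrib right_diff_distrib
        mult.assoc)
  ultimately show ?thesis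
    by (simp only:) (simp add: algebra_simps)
qed

lemma pder_commute_word:
  assumes "m \<ge> 1" "n \<ge> 1"
  shows "pder m (pder n (word w)) = pder n (pder m (word w))"
proof (induction w)
  case Nil
  then show ?case using assms by (simp add: word_Nil pder_1)
next
  case (Cons a w)
  have X: "pder m (pder n X) = pder n (pder m X)"
    using assms by (simp add: pder_pder_X add.commute)
  have minus: "pder k Y = - pder k X" if "k \<ge> 1" for k
    using that by (simp add: pder_X pder_Y)
  have Y: "pder m (pder n Y) = pder n (pder m Y)"
    using assms by (simp add: minus pder_uminus X)
  have a: "pder m (pder n (word [a])) = pder n (pder m (word [a]))"
    using X Y by (cases a) (simp_all add: X_def Y_def)
  have "word (a # w) = word [a] * word w"
    by (simp add: word_append)
  then show ?case
    using assms by (simp add: pder_mult pder_add a Cons.IH)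
qed

text \<open>A coefficient at \<open>u\<close> depends only on words no longer than \<open>u\<close>,
  so \<open>f\<close> may be replaced by a finite combination of words.\<close>

lemma pder_commute:
  assumes "m \<ge> 1" "n \<ge> 1"
  shows "pder m (pder n f) = pder n (pder m f)"
proof (rule ncs_eqI)
  fix u :: "letter list"
  let ?f = "truncate (length u) f"
  have trunc: "coeff (pder i (pder j f)) u = coeff (pder i (pder j ?f)) u"
    if "i \<ge> 1" "j \<ge> 1" for i j
    by (intro coeff_pder_cong that) (simp add: coeff_truncate)
  have "pder m (pder n ?f) = pder n (pder m ?f)"
    using assms
    by (simp add: truncate_def pder_sum pder_smult pder_commute_word)
  then show "coeff (pder m (pder n f)) u = coeff (pder n (pder m f)) u"
    using assms by (simp add: trunc)
qed

section \<open>The homogeneous parts of the exponential\<close>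

lemma smult_left_cancel: "c \<noteq> 0 \<Longrightarrow> smult c f = smult c g \<Longrightarrow> f = g"
  by (metis left_inverse smult_1_left smult_smult)

lemma smult_add_left: "smult (c + d) f = smult c f + smult d f"
  by (rule ncs_eqI) (simp add: algebra_simps)

lemma log_theta_add: "log_theta n (f + g) = log_theta n f + log_theta n g"
  by (simp add: log_theta_def pder_add smult_add_right)

lemma log_theta_smult: "log_theta n (smult c f) = smult c (log_theta n f)"
  by (simp add: log_theta_def pder_smult smult_smult mult.commute)

lemma log_theta_sum: "log_theta n (\<Sum>i\<in>A. F i) = (\<Sum>i\<in>A. log_theta n (F i))"
  by (induction A rule: infinite_finite_induct) (simp_all add: log_theta_add)

lemma log_theta_mult: "log_theta n (f * g) = log_theta n f * g + f * log_theta n g"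
  by (simp add: log_theta_def pder_mult smult_add_right smult_mult_left smult_mult_right)

lemma log_theta_commute: "log_theta m (log_theta n f) = log_theta n (log_theta m f)"
  by (cases "m = 0"; cases "n = 0")
     (simp_all add: log_theta_def pder_smult smult_smult mult.commute pder_commute [of m n])

lemma smult_log_theta: "smult (of_nat n) (log_theta n f) = (if n = 0 then 0 else pder n f)"
  by (simp add: log_theta_def smult_smult)

lemma sum_triangle_swap:
  fixes h :: "nat \<Rightarrow> nat \<Rightarrow> 'a::comm_monoid_add"
  shows "(\<Sum>i\<le>l. \<Sum>j\<le>l - i. h i j) = (\<Sum>j\<le>l. \<Sum>i\<le>l - j. h i j)"
  unfolding sum.Sigma [OF finite_atMost ballI [OF finite_atMost]]
  by (rule sum.reindex_bij_witness [of _ prod.swap prod.swap]) auto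

lemma sum_triangle_diagonal:
  fixes h :: "nat \<Rightarrow> nat \<Rightarrow> 'a::comm_monoid_add"
  shows "(\<Sum>i\<le>l. \<Sum>j\<le>l - i. h i j) = (\<Sum>a\<le>l. \<Sum>i\<le>a. h i (a - i))"
  unfolding sum.Sigma [OF finite_atMost ballI [OF finite_atMost]]
  by (rule sum.reindex_bij_witness [of _ "\<lambda>(a, i). (i, a - i)" "\<lambda>(i, j). (i + j, i)"]) auto

lemma gop_power_log_theta_Suc:
  "gop_power log_theta (Suc k) l f = (\<Sum>i\<le>l. log_theta i (gop_power log_theta k (l - i) f))"
  by (simp add: gop_mult_def)

text \<open>The derivative of the \<open>k\<close>-th power with respect to the grading variable.\<close>

lemma smult_gop_power_Suc:
  "smult (of_nat l) (gop_power log_theta (Suc k) l f) =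
   smult (of_nat (Suc k))
     (\<Sum>i\<le>l. smult (of_nat i) (log_theta i (gop_power log_theta k (l - i) f)))"
proof (induction k arbitrary: l)
  case 0
  \<comment> \<open>Only \<open>i = l\<close> survives, as \<open>gop_one\<close> vanishes in
    positive degree. The abstract \<open>c\<close> serves both sides: once as the identity, once as
    the weight \<open>i\<close>.\<close>
  have "(\<Sum>i\<le>l. c i (log_theta i (gop_one (l - i) f))) = c l (log_theta l f)"
    if "\<And>i. c i 0 = 0" for c :: "nat \<Rightarrow> ncs \<Rightarrow> ncs"
  proof -
    have "(\<Sum>i\<le>l. c i (log_theta i (gop_one (l - i) f))) =
        (\<Sum>i\<in>{l}. c i (log_theta i (gop_one (l - i) f)))"
      by (rule sum.mono_neutral_right) (auto simp: gop_one_def that)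
    then show ?thesis by (simp add: gop_one_def)
  qed
  from this [of "\<lambda>_ g. g"] this [of "\<lambda>i. smult (of_nat i)"] show ?case
    by (simp add: gop_mult_def)
next
  case (Suc k)
  let ?P = "gop_power log_theta" and ?L = log_theta
  \<comment> \<open>Product rule for the Euler operator: the weight \<open>l\<close> splits as
    \<open>i + (l - i)\<close>, and the induction hypothesis applies to the second part.\<close>
  have "smult (of_nat l) (?P (Suc (Suc k)) l f) =
      (\<Sum>i\<le>l. smult (of_nat i) (?L i (?P (Suc k) (l - i) f))
            + ?L i (smult (of_nat (l - i)) (?P (Suc k) (l - i) f)))"
    unfolding gop_power_log_theta_Suc [of "Suc k"] smult_sum_right
    by (intro sum.cong refl)
       (simp add: log_theta_smult smult_add_left [symmetric] of_nat_diff
         del: gop_power.simps)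
  also have "\<dots> = (\<Sum>i\<le>l. smult (of_nat i) (?L i (?P (Suc k) (l - i) f)))
      + smult (of_nat (Suc k))
          (\<Sum>i\<le>l. \<Sum>j\<le>l - i. smult (of_nat j) (?L i (?L j (?P k (l - i - j) f))))"
    unfolding sum.distrib Suc.IH by (simp only: log_theta_smult log_theta_sum smult_sum_right)
  \<comment> \<open>Commutativity enters here: with the weighted factor in front, the other sum
    reassembles into the power \<open>Suc k\<close>.\<close>
  also have "(\<Sum>i\<le>l. \<Sum>j\<le>l - i. smult (of_nat j) (?L i (?L j (?P k (l - i - j) f)))) =
      (\<Sum>i\<le>l. \<Sum>j\<le>l - i. smult (of_nat j) (?L j (?L i (?P k (l - j - i) f))))"
    by (simp only: log_theta_commute [of i j for i j] diff_commute [of l])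
  also have "(\<Sum>i\<le>l. \<Sum>j\<le>l - i. smult (of_nat j) (?L j (?L i (?P k (l - j - i) f)))) =
      (\<Sum>j\<le>l. smult (of_nat j) (?L j (?P (Suc k) (l - j) f)))"
    by (subst sum_triangle_swap)
       (simp add: gop_power_log_theta_Suc log_theta_sum smult_sum_right del: gop_power.simps)
  finally show ?case
    by (simp only: of_nat_Suc [of "Suc k"] smult_add_left smult_1_left)
qed

lemma theta_eq_superset:
  assumes "l \<le> N"
  shows "theta l f = (\<Sum>k\<le>N. smult (1 / fact k) (gop_power log_theta k l f))"
  unfolding theta_eq
  by (rule sum.mono_neutral_left) (use assms in \<open>auto simp: gop_power_log_theta_eq_0\<close>)

text \<open>Coefficient of \<open>s^l\<close> in
  \<open>s * d/ds exp L = (s * d/ds L) * exp L\<close>, where \<open>L\<close> is the series of the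
  \<open>log_theta i\<close>; it follows power by power from
  \<open>smult_gop_power_Suc\<close>.\<close>

lemma theta_newton:
  "smult (of_nat l) (theta l f) = (\<Sum>i\<le>l. smult (of_nat i) (log_theta i (theta (l - i) f)))"
proof (cases l)
  case (Suc N)
  let ?P = "gop_power log_theta"
  have fact: "1 / fact (Suc k) * of_nat (Suc k) = (1 / fact k :: rat)" for k
    by (simp add: divide_simps del: of_nat_Suc)
  have "smult (of_nat l) (theta l f) = (\<Sum>k\<le>Suc N. smult (1 / fact k) (smult (of_nat l) (?P k l f)))"
    by (simp only: theta_eq smult_sum_right smult_smult mult.commute Suc)
  also have "\<dots> = (\<Sum>k\<le>N. smult (1 / fact (Suc k)) (smult (of_nat l) (?P (Suc k) l f)))"
    by (subst sum.atMost_Suc_shift) (simp add: gop_one_def Suc)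
  also have "\<dots> = (\<Sum>k\<le>N. \<Sum>i\<le>l. smult (of_nat i) (log_theta i (smult (1 / fact k) (?P k (l - i) f))))"
    unfolding smult_gop_power_Suc smult_smult fact smult_sum_right log_theta_smult
    by (simp add: smult_smult mult.commute)
  also have "\<dots> = (\<Sum>i\<le>l. smult (of_nat i) (log_theta i (\<Sum>k\<le>N. smult (1 / fact k) (?P k (l - i) f))))"
    by (subst sum.swap) (simp add: log_theta_sum smult_sum_right)
  also have "\<dots> = (\<Sum>i\<le>l. smult (of_nat i) (log_theta i (theta (l - i) f)))"
  proof (intro sum.cong refl)
    fix i assume "i \<in> {..l}"
    show "smult (of_nat i) (log_theta i (\<Sum>k\<le>N. smult (1 / fact k) (?P k (l - i) f))) =
        smult (of_nat i) (log_theta i (theta (l - i) f))"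
    proof (cases "i = 0")
      case False
      then have "l - i \<le> N" using Suc by simp
      then show ?thesis by (simp add: theta_eq_superset)
    qed simp
  qed
  finally show ?thesis .
qed simp

section \<open>Additivity, multiplicativity and values on the letters\<close>

lemma gop_power_log_theta_add:
  "gop_power log_theta k l (f + g) = gop_power log_theta k l f + gop_power log_theta k l g"
  by (induction k arbitrary: l)
     (simp_all add: gop_one_def gop_mult_def log_theta_add sum.distrib)

lemma theta_add: "theta l (f + g) = theta l f + theta l g"
  by (simp add: theta_eq gop_power_log_theta_add smult_add_right sum.distrib)

lemma theta_diff: "theta l (f - g) = theta l f - theta l g"
  using theta_add [of l "f - g" g] by (simp add: algebra_simps)

lemma theta_0_right [simp]: "theta l 0 = 0"
  using theta_diff [of l 0 0] by simp

text \<open>Both sides obey the recursion \<open>theta_newton\<close>: a derivation acts on one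
  factor at a time, and the weights \<open>a\<close> and \<open>l - a\<close> add up to
  \<open>l\<close>. The summand \<open>i = 0\<close> has weight zero, so only lower degrees enter
  the induction.\<close>

lemma theta_mult: "theta l (f * g) = (\<Sum>j\<le>l. theta j f * theta (l - j) g)"
proof (induction l rule: less_induct)
  case (less l)
  let ?D = "\<lambda>i f. smult (of_nat i) (log_theta i f)"
  show ?case
  proof (cases "l = 0")
    case False
    have "smult (of_nat l) (theta l (f * g)) = (\<Sum>i\<le>l. ?D i (theta (l - i) (f * g)))"
      by (rule theta_newton)
    also have "\<dots> = (\<Sum>i\<le>l. ?D i (\<Sum>j\<le>l - i. theta j f * theta (l - i - j) g))"
    proof (intro sum.cong refl)
      fix i assume "i \<in> {..l}"
      then show "?D i (theta (l - i) (f * g)) =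
          ?D i (\<Sum>j\<le>l - i. theta j f * theta (l - i - j) g)"
        using less.IH [of "l - i"] False by (cases "i = 0") simp_all
    qed
    also have "\<dots> =
        (\<Sum>i\<le>l. \<Sum>j\<le>l - i. ?D i (theta j f) * theta (l - (i + j)) g) +
        (\<Sum>i\<le>l. \<Sum>j\<le>l - i. theta j f * ?D i (theta (l - (j + i)) g))"
      by (simp add: log_theta_sum log_theta_mult smult_sum_right smult_add_right sum.distrib
          smult_mult_left smult_mult_right add.commute)
    also have "(\<Sum>i\<le>l. \<Sum>j\<le>l - i. ?D i (theta j f) * theta (l - (i + j)) g) =
        (\<Sum>a\<le>l. smult (of_nat a) (theta a f) * theta (l - a) g)"
      by (subst sum_triangle_diagonal) (simp add: theta_newton sum_distrib_right)
    also have "(\<Sum>i\<le>l. \<Sum>j\<le>l - i. theta j f * ?D i (theta (l - (j + i)) g)) =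
        (\<Sum>a\<le>l. theta a f * smult (of_nat (l - a)) (theta (l - a) g))"
      by (subst sum_triangle_swap) (simp only: theta_newton sum_distrib_left diff_diff_left)
    also have "(\<Sum>a\<le>l. smult (of_nat a) (theta a f) * theta (l - a) g) +
        (\<Sum>a\<le>l. theta a f * smult (of_nat (l - a)) (theta (l - a) g)) =
        smult (of_nat l) (\<Sum>j\<le>l. theta j f * theta (l - j) g)"
      unfolding sum.distrib [symmetric] smult_sum_right
      by (intro sum.cong refl)
         (simp add: smult_mult_left smult_mult_right smult_add_left [symmetric]
           of_nat_add [symmetric] del: of_nat_add)
    finally show ?thesis
      by (rule smult_left_cancel [rotated]) (use False in simp)
  qed (simp add: theta_0)
qed

text \<open>This is the recursion that identifies \<open>X * Y ^ l\<close> as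
  \<open>theta l X\<close>. Splitting off the last \<open>Y\<close> by the Leibniz rule leaves the
  previous degree and a telescoping sum.\<close>

lemma sum_pder_X_Y_power:
  "(\<Sum>n=1..l. pder n (X * Y ^ (l - n))) = smult (of_nat l) (X * Y ^ l)"
proof (induction l)
  case (Suc l)
  \<comment> \<open>With \<open>X = (X + Y) - Y\<close> each summand becomes a difference of
    consecutive terms \<open>Y ^ (l - n) * (X + Y) ^ n\<close>.\<close>
  have tel: "(\<Sum>n=1..l. Y ^ (l - n) * X * (X + Y) ^ (n - 1)) = (X + Y) ^ l - Y ^ l" for l
  proof (induction l)
    case (Suc l)
    have "(\<Sum>n=1..l. Y ^ (Suc l - n) * X * (X + Y) ^ (n - 1)) =
        Y * (\<Sum>n=1..l. Y ^ (l - n) * X * (X + Y) ^ (n - 1))"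
      by (simp add: sum_distrib_left Suc_diff_le mult.assoc)
    then show ?case unfolding Suc.IH by (simp add: algebra_simps)
  qed simp
  have "(\<Sum>n=1..l. pder n (X * Y ^ (Suc l - n))) =
      (\<Sum>n=1..l. pder n (X * Y ^ (l - n)) * Y - X * (Y ^ (l - n) * X * (X + Y) ^ (n - 1)) * Y)"
  proof (intro sum.cong refl)
    fix n assume "n \<in> {1..l}"
    then have "X * Y ^ (Suc l - n) = (X * Y ^ (l - n)) * Y" and "n \<ge> 1"
      by (auto simp: Suc_diff_le power_commutes mult.assoc)
    then show "pder n (X * Y ^ (Suc l - n)) =
        pder n (X * Y ^ (l - n)) * Y - X * (Y ^ (l - n) * X * (X + Y) ^ (n - 1)) * Y"
      by (simp only: pder_mult [of n "X * Y ^ (l - n)"] pder_Y) (simp add: mult.assoc)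
  qed
  also have "\<dots> = (\<Sum>n=1..l. pder n (X * Y ^ (l - n))) * Y
      - X * (\<Sum>n=1..l. Y ^ (l - n) * X * (X + Y) ^ (n - 1)) * Y"
    by (simp add: sum_subtractf sum_distrib_left sum_distrib_right)
  also have "\<dots> = smult (of_nat l) (X * Y ^ l) * Y - X * ((X + Y) ^ l - Y ^ l) * Y"
    by (simp only: Suc.IH tel)
  \<comment> \<open>The remaining summand \<open>pder (Suc l) X = X * (X + Y) ^ l * Y\<close>
    cancels the same term with negative sign.\<close>
  finally show ?case
    by (simp add: pder_X smult_mult_left smult_add_left power_commutes algebra_simps mult.assoc)
qed simp

lemma theta_X: "theta l X = X * Y ^ l"
proof (induction l rule: less_induct)
  case (less l)
  show ?case
  proof (cases "l = 0")
    case False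
    have "smult (of_nat l) (theta l X) = (\<Sum>i\<le>l. smult (of_nat i) (log_theta i (theta (l - i) X)))"
      by (rule theta_newton)
    also have "\<dots> = (\<Sum>n=1..l. pder n (X * Y ^ (l - n)))"
      by (rule sum.mono_neutral_cong_right) (auto simp: smult_log_theta less.IH)
    also have "\<dots> = smult (of_nat l) (X * Y ^ l)"
      by (rule sum_pder_X_Y_power)
    finally show ?thesis
      by (rule smult_left_cancel [rotated]) (use False in simp)
  qed (simp add: theta_0)
qed

lemma theta_eq_0_of_log_theta:
  assumes "\<And>n. log_theta n f = 0" "l \<ge> 1"
  shows "theta l f = 0"
  using \<open>l \<ge> 1\<close>
proof (induction l rule: less_induct)
  case (less l)
  have "log_theta i (theta (l - i) f) = 0" if "i \<in> {..l}" for i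
    using that less.IH [of "l - i"] assms(1) [of i]
    by (cases "i = 0"; cases "i = l") (auto simp: theta_0 log_theta_def [of 0])
  then have "smult (of_nat l) (theta l f) = smult (of_nat l) 0"
    by (simp add: theta_newton)
  then show ?case
    by (rule smult_left_cancel [rotated]) (use less.prems in simp)
qed

lemma theta_1_right: "theta l 1 = (if l = 0 then 1 else 0)"
  by (simp add: theta_0 theta_eq_0_of_log_theta log_theta_def pder_1)

lemma theta_XY: "theta l (X + Y) = (if l = 0 then X + Y else 0)"
  by (simp add: theta_0 theta_eq_0_of_log_theta log_theta_def pder_X pder_Y pder_add)

lemma theta_Y: "theta l Y = (if l = 0 then Y else - (X * Y ^ l))"
  using theta_add [of l X Y]
  by (auto simp: theta_XY theta_X theta_0 eq_neg_iff_add_eq_0 add.commute)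

section \<open>The generating series of the homogeneous parts\<close>

unbundle fps_syntax

text \<open>The exponential with a formal grading parameter \<open>fps_X\<close>, which is central
  although the coefficients do not commute.\<close>

definition theta_fps :: "ncs \<Rightarrow> ncs fps" where
  "theta_fps f = Abs_fps (\<lambda>l. theta l f)"

lemma theta_fps_nth [simp]: "theta_fps f $ l = theta l f"
  by (simp add: theta_fps_def)

lemma theta_fps_diff: "theta_fps (f - g) = theta_fps f - theta_fps g"
  by (simp add: fps_eq_iff theta_diff)

lemma theta_fps_mult: "theta_fps (f * g) = theta_fps f * theta_fps g"
  by (simp add: fps_eq_iff theta_mult fps_mult_nth atLeast0AtMost)

lemma theta_fps_1: "theta_fps 1 = 1"
  by (simp add: fps_eq_iff theta_1_right)

lemma theta_fps_XY: "theta_fps (X + Y) = fps_const (X + Y)"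
  by (simp add: fps_eq_iff theta_XY)

lemma theta_fps_X: "theta_fps X = fps_const X * Abs_fps (\<lambda>k. Y ^ k)"
  by (simp add: fps_eq_iff theta_X)

lemma theta_fps_Y: "theta_fps Y = (1 - fps_X * theta_fps X) * fps_const Y"
proof (rule fps_ext)
  fix l
  show "theta_fps Y $ l = ((1 - fps_X * theta_fps X) * fps_const Y) $ l"
    by (cases l) (simp_all add: theta_Y theta_X left_diff_distrib mult.assoc power_commutes)
qed

text \<open>The difference \<open>D = F - G\<close> satisfies \<open>D = fps_X * (A * D)\<close>, so
  each coefficient is determined by earlier ones and vanishes.\<close>

lemma one_minus_fps_X_mult_left_cancel:
  fixes A F G :: "'a::ring_1 fps"
  assumes "(1 - fps_X * A) * F = (1 - fps_X * A) * G"
  shows "F = G"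
proof (rule fps_ext)
  have *: "F - G = fps_X * (A * (F - G))"
    using assms by (simp add: algebra_simps)
  fix n
  have "(F - G) $ n = 0"
  proof (induction n rule: less_induct)
    case (less n)
    have "(A * (F - G)) $ k = 0" if "k < n" for k
      unfolding fps_mult_nth using that less.IH by (intro sum.neutral) auto
    then show ?case
      by (subst *) simp
  qed
  then show "F $ n = G $ n" by simp
qed

lemma one_minus_fps_X_mult_powers:
  fixes a b :: "'a::ring_1"
  shows "(1 - fps_X * fps_const a) * Abs_fps (\<lambda>k. a ^ k * b) = fps_const b"
proof (rule fps_ext)
  fix n
  show "((1 - fps_X * fps_const a) * Abs_fps (\<lambda>k. a ^ k * b)) $ n = fps_const b $ n"
    by (cases n) (simp_all add: left_diff_distrib mult.assoc)
qed

text \<open>\<open>theta_powers f g\<close> is the image of \<open>1/(1 - s f) g\<close> under the \<open>s\<close>-linear extension of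
  \<open>theta_fps\<close>, where \<open>s = fps_X\<close>.\<close>

definition theta_powers :: "ncs \<Rightarrow> ncs \<Rightarrow> ncs fps" where
  "theta_powers f g = Abs_fps (\<lambda>m. \<Sum>i\<le>m. theta i (f ^ (m - i) * g))"

text \<open>Image of \<open>(1 - s f) * (1/(1 - s f) * g) = g\<close> under the multiplicative
  \<open>theta_fps\<close>.\<close>

lemma theta_powers_eq: "(1 - fps_X * theta_fps f) * theta_powers f g = theta_fps g"
proof (rule fps_ext)
  fix m
  show "((1 - fps_X * theta_fps f) * theta_powers f g) $ m = theta_fps g $ m"
  proof (cases m)
    case (Suc n)
    have "(\<Sum>i\<le>n. theta i (f ^ (Suc n - i) * g)) =
        (\<Sum>i\<le>n. \<Sum>a\<le>i. theta a f * theta (i - a) (f ^ (n - (a + (i - a))) * g))"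
      by (intro sum.cong refl) (simp add: Suc_diff_le mult.assoc theta_mult)
    also have "\<dots> = (\<Sum>a\<le>n. theta a f * (\<Sum>i\<le>n - a. theta i (f ^ (n - a - i) * g)))"
      by (subst sum_triangle_diagonal [symmetric]) (simp add: sum_distrib_left)
    also have "\<dots> = (theta_fps f * theta_powers f g) $ n"
      by (simp add: theta_powers_def fps_mult_nth atLeast0AtMost)
    finally show ?thesis
      using Suc by (simp add: theta_powers_def left_diff_distrib mult.assoc)
  qed (simp add: theta_powers_def left_diff_distrib mult.assoc)
qed

text \<open>\<open>theta_fps Y\<close> carries on its left exactly the factor
  \<open>1 - fps_X * theta_fps X\<close> that the series inverts.\<close>

lemma theta_powers_X_Y: "theta_powers X (Y * h) = fps_const Y * theta_fps h"
  by (rule one_minus_fps_X_mult_left_cancel [where A = "theta_fps X"])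
     (simp add: theta_powers_eq theta_fps_mult theta_fps_Y mult.assoc)


text \<open>The defect \<open>d\<close> satisfies \<open>d = f * d\<close>, so its order exceeds
  every bound.\<close>

lemma geom_left_inverse:
  assumes "order_ge f 1"
  shows "geom f * (1 - f) = 1"
proof -
  define d where "d = geom f * (1 - f) - 1"
  have "(1 - f) * d = (1 - f) * geom f * (1 - f) - (1 - f)"
    by (simp only: d_def right_diff_distrib mult.assoc mult_1_right)
  then have "d - f * d = 0"
    by (simp only: geom_inverse [OF assms] mult_1_left diff_self left_diff_distrib [of 1 f d])
  then have d: "d = f * d"
    by (rule iffD1 [OF right_minus_eq])
  have ord: "order_ge d n" for n
  proof (induction n)
    case (Suc n)
    then show ?case
      using order_ge_mult [OF assms, of d n] by (subst d) simp
  qed simp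
  have "d = 0"
  proof (rule ncs_eqI)
    fix u :: "letter list"
    show "coeff d u = coeff 0 u"
      using ord [of "Suc (length u)"] by (simp add: order_ge_def)
  qed
  then show ?thesis by (simp add: d_def)
qed

lemma geom_Y_left: "(1 - Y) * geom Y = 1" and geom_Y_right: "geom Y * (1 - Y) = 1"
  and geom_X_left: "(1 - X) * geom X = 1" and geom_X_right: "geom X * (1 - X) = 1"
  by (intro geom_inverse geom_left_inverse order_ge_X order_ge_Y)+

text \<open>Write \<open>T\<close> for \<open>theta_fps\<close>. Multiplying the defining equation
  by \<open>1 - T Y\<close> clears the inverse in \<open>T (geom Y * X)\<close>. Since
  \<open>T Y = (1 - s T X) * Y\<close>, both sides then have the left factor
  \<open>1 - s T X\<close>, which cancels.\<close>

lemma theta_powers_geom_Y_X: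
  "theta_powers (geom Y * X) Y = fps_const (geom Y * Y) * (1 - theta_fps Y)"
proof -
  let ?T = theta_fps and ?s = "fps_X :: ncs fps" and ?G = "theta_powers (geom Y * X) Y"
  have T: "(1 - ?T Y) * ?T (geom Y * X) = ?T X"
    by (simp add: theta_fps_1 [symmetric] theta_fps_diff [symmetric] theta_fps_mult [symmetric]
        mult.assoc [symmetric] geom_Y_left)
  have "(1 - ?s * ?T X) * (fps_const (1 - Y) * ?G) = (1 - ?T Y - ?s * ?T X) * ?G"
    by (simp add: theta_fps_Y algebra_simps fps_const_sub [symmetric] del: fps_const_sub)
  also have "\<dots> = (1 - ?T Y) * ((1 - ?s * ?T (geom Y * X)) * ?G)"
    by (simp add: T [symmetric] algebra_simps fps_mult_fps_X_commute [symmetric])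
       (metis fps_mult_fps_X_commute mult.assoc)
  also have "\<dots> = (1 - ?T Y) * ?T Y"
    by (simp add: theta_powers_eq)
  also have "\<dots> = ?T Y * (1 - ?T Y)"
    by (simp add: algebra_simps)
  also have "\<dots> = (1 - ?s * ?T X) * (fps_const Y * (1 - ?T Y))"
    by (subst (1) theta_fps_Y) (simp add: mult.assoc)
  finally have "fps_const (1 - Y) * ?G = fps_const Y * (1 - ?T Y)"
    by (rule one_minus_fps_X_mult_left_cancel)
  then have "fps_const (geom Y) * (fps_const (1 - Y) * ?G) = fps_const (geom Y) * (fps_const Y * (1 - ?T Y))"
    by simp
  then show ?thesis
    by (simp add: mult.assoc [symmetric] geom_Y_right)
qed

section \<open>Closed forms of the sums over \<open>theta i\<close>\<close>

lemma sum_theta_X_Y: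
  assumes "m \<ge> 1"
  shows "(\<Sum>i<m. theta i (X ^ (m - i) * Y)) = X * Y ^ m"
proof -
  \<comment> \<open>By the collapse the series is the constant \<open>Y\<close>; its coefficient at
    \<open>m\<close> contains one more term than the sum,
    \<open>theta m Y = - (X * Y ^ m)\<close>.\<close>
  have "theta_powers X (Y * 1) $ m = 0"
    using assms unfolding theta_powers_X_Y by (simp add: theta_1_right)
  then have "(\<Sum>i<m. theta i (X ^ (m - i) * Y)) + theta m Y = 0"
    by (simp add: theta_powers_def lessThan_Suc_atMost [symmetric])
  then show ?thesis
    using assms by (simp add: theta_Y)
qed

lemma sum_theta_geom_Y_X_Y:
  assumes "m \<ge> 1"
  shows "(\<Sum>i<m. theta i ((geom Y * X) ^ (m - i) * Y)) = geom Y * X * Y ^ m"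
proof -
  have "theta_powers (geom Y * X) Y $ m = geom Y * Y * (X * Y ^ m)"
    using assms unfolding theta_powers_geom_Y_X by (simp add: theta_Y)
  then have "(\<Sum>i<m. theta i ((geom Y * X) ^ (m - i) * Y)) = geom Y * Y * (X * Y ^ m) - theta m Y"
    by (simp add: theta_powers_def lessThan_Suc_atMost [symmetric] algebra_simps)
  \<comment> \<open>The coefficient \<open>1\<close> of \<open>- theta m Y = X * Y ^ m\<close> is
    written as \<open>geom Y * (1 - Y)\<close>.\<close>
  also have "\<dots> = (geom Y * Y + geom Y * (1 - Y)) * (X * Y ^ m)"
    using assms by (simp add: theta_Y geom_Y_right distrib_right)
  finally show ?thesis
    by (simp add: algebra_simps)
qed

text \<open>With \<open>h = 1 - geom X * Y\<close>, the product
  \<open>(1 - X) * h = 1 - (X + Y)\<close> is fixed by \<open>theta_fps\<close>. Together with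
  \<open>theta_fps X = X * v\<close>, \<open>v = 1/(1 - s Y)\<close>, this determines
  \<open>v * theta_fps h\<close> as the geometric series with ratio \<open>geom X * Y\<close>
  applied to \<open>h\<close>.\<close>

lemma sum_theta_X_Y_1_minus_pY:
  "(\<Sum>i<Suc M. theta i (X ^ (Suc M - i) * (Y * (1 - geom X * Y)))) = X * Y * (geom X * Y) ^ M * (1 - geom X * Y)"
proof -
  let ?T = theta_fps and ?s = "fps_X :: ncs fps"
  let ?h = "1 - geom X * Y" and ?v = "Abs_fps (\<lambda>k. Y ^ k)"
  have v: "(1 - ?s * fps_const Y) * ?v = 1"
    using one_minus_fps_X_mult_powers [of Y 1] by simp
  have h: "(1 - X) * ?h = 1 - (X + Y)"
    by (simp add: right_diff_distrib mult.assoc [symmetric] geom_X_left)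
  have "(1 - fps_const X - ?s * fps_const Y) * ?v = 1 - ?T X"
    using v by (simp add: theta_fps_X algebra_simps)
  then have "(1 - fps_const X - ?s * fps_const Y) * (?v * ?T ?h) = (1 - ?T X) * ?T ?h"
    by (simp add: mult.assoc [symmetric])
  also have "\<dots> = ?T ((1 - X) * ?h)"
    by (simp add: theta_fps_mult theta_fps_diff theta_fps_1)
  also have "\<dots> = fps_const (1 - (X + Y))"
    unfolding h by (simp only: theta_fps_diff theta_fps_1 theta_fps_XY
        fps_const_1_eq_1 [symmetric] fps_const_sub)
  finally have eq: "(1 - fps_const X - ?s * fps_const Y) * (?v * ?T ?h) = fps_const (1 - (X + Y))" .
  have pXY: "fps_const (geom X) * (1 - fps_const X - ?s * fps_const Y) = 1 - ?s * fps_const (geom X * Y)"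
  proof -
    have "fps_const (geom X) * (1 - fps_const X - ?s * fps_const Y) =
        fps_const (geom X * (1 - X)) - fps_const (geom X) * ?s * fps_const Y"
      by (simp add: algebra_simps fps_const_sub [symmetric] del: fps_const_sub)
    also have "fps_const (geom X) * ?s = ?s * fps_const (geom X)"
      by (rule fps_mult_fps_X_commute [symmetric])
    finally show ?thesis
      by (simp add: geom_X_right mult.assoc)
  qed
  have ph: "geom X * (1 - (X + Y)) = ?h"
    by (simp only: diff_diff_eq [symmetric] right_diff_distrib [of _ "1 - X"] geom_X_right)
  have "(1 - ?s * fps_const (geom X * Y)) * (?v * ?T ?h) =
      fps_const (geom X) * ((1 - fps_const X - ?s * fps_const Y) * (?v * ?T ?h))"
    by (simp only: pXY mult.assoc [symmetric])
  also have "\<dots> = fps_const ?h"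
    by (simp only: eq fps_const_mult ph)
  finally have eq': "(1 - ?s * fps_const (geom X * Y)) * (?v * ?T ?h) = fps_const ?h" .
  have vTh: "?v * ?T ?h = Abs_fps (\<lambda>k. (geom X * Y) ^ k * ?h)"
    by (rule one_minus_fps_X_mult_left_cancel [where A = "fps_const (geom X * Y)"])
       (simp only: eq' one_minus_fps_X_mult_powers)
  have v_comm: "?v * fps_const Y = fps_const Y * ?v"
    by (simp add: fps_eq_iff power_commutes)
  \<comment> \<open>Subtracting \<open>theta_fps (Y * h)\<close> removes the term
    \<open>i = Suc M\<close>, which the sum omits.\<close>
  have "theta_powers X (Y * ?h) - ?T (Y * ?h) = ?s * (?T X * fps_const Y * ?T ?h)"
    unfolding theta_powers_X_Y theta_fps_mult theta_fps_Y by (simp add: algebra_simps)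
  also have "?T X * fps_const Y * ?T ?h = fps_const (X * Y) * (?v * ?T ?h)"
    unfolding theta_fps_X fps_const_mult [symmetric] by (simp only: mult.assoc v_comm)
  finally have "(theta_powers X (Y * ?h) - ?T (Y * ?h)) $ Suc M = X * Y * (geom X * Y) ^ M * ?h"
    unfolding vTh by (simp add: mult.assoc)
  then show ?thesis
    by (simp add: theta_powers_def lessThan_Suc_atMost del: sum.lessThan_Suc)
qed

section \<open>The automorphism\<close>

lemma order_ge_theta: "order_ge (theta l f) l"
  by (simp add: theta_eq order_ge_sum order_ge_smult order_ge_gop_power)

lemma coeff_theta_eq_0: "length u < l \<Longrightarrow> coeff (theta l f) u = 0"
  using order_ge_theta by (simp add: order_ge_def)

lemma coeff_Theta:
  assumes "length u \<le> N"
  shows "coeff (Theta f) u = coeff (\<Sum>l\<le>N. theta l f) u"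
  unfolding Theta_def coeff_sum
  by (rule coeff_nc_sum_finite) (use assms coeff_theta_eq_0 in \<open>force intro: leI\<close>)+

lemma Theta_diff: "Theta (f - g) = Theta f - Theta g"
  by (rule ncs_eqI) (simp add: coeff_Theta [OF order_refl] theta_diff sum_subtractf)

lemma Theta_add: "Theta (f + g) = Theta f + Theta g"
  using Theta_diff [of "f + g" g] by (simp add: algebra_simps)

lemma Theta_eqI_0:
  assumes "\<And>l. l \<ge> 1 \<Longrightarrow> theta l f = 0"
  shows "Theta f = f"
proof (rule ncs_eqI)
  fix u :: "letter list"
  have "(\<Sum>l\<le>length u. theta l f) = (\<Sum>l\<in>{0}. theta l f)"
    by (rule sum.mono_neutral_right) (auto simp: assms)
  then show "coeff (Theta f) u = coeff f u"
    by (simp add: coeff_Theta [OF order_refl] theta_0)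
qed

lemma Theta_1: "Theta 1 = 1"
  by (rule Theta_eqI_0) (simp add: theta_1_right)

lemma Theta_XY: "Theta (X + Y) = X + Y"
  by (rule Theta_eqI_0) (simp add: theta_XY)

lemma Theta_X: "Theta X = X * geom Y"
proof (rule ncs_eqI)
  fix u :: "letter list"
  have "coeff (geom Y) v = coeff (\<Sum>k\<le>length u. Y ^ k) v" if "length v \<le> length u" for v
    unfolding geom_def coeff_sum
  proof (rule coeff_nc_sum_finite)
    fix k assume "coeff (Y ^ k) v \<noteq> 0"
    with order_ge_power [OF order_ge_Y, of k] have "\<not> length v < k"
      by (auto simp: order_ge_def)
    with that show "k \<in> {..length u}" by simp
  qed simp
  then have "coeff (X * geom Y) u = coeff (X * (\<Sum>k\<le>length u. Y ^ k)) u"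
    by (intro coeff_mult_cong) auto
  then show "coeff (Theta X) u = coeff (X * geom Y) u"
    by (simp add: coeff_Theta [OF order_refl] theta_X sum_distrib_left)
qed

text \<open>By order, only pairs with \<open>a + b \<le> length u\<close> contribute at
  \<open>u\<close>; these form the Cauchy products of \<open>theta_mult\<close>.\<close>

lemma Theta_mult: "Theta (f * g) = Theta f * Theta g"
proof (rule ncs_eqI)
  fix u :: "letter list"
  let ?N = "length u"
  have Theta: "coeff (Theta h) v = coeff (\<Sum>l\<le>?N. theta l h) v" if "length v \<le> ?N" for h v
    using that by (rule coeff_Theta)
  have "coeff (Theta f * Theta g) u = coeff ((\<Sum>l\<le>?N. theta l f) * (\<Sum>l\<le>?N. theta l g)) u"
    by (intro coeff_mult_cong Theta)
  also have "\<dots> = (\<Sum>a\<le>?N. \<Sum>b\<le>?N. coeff (theta a f * theta b g) u)"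
    by (simp add: sum_product coeff_sum)
  also have "\<dots> = (\<Sum>a\<le>?N. \<Sum>b\<le>?N - a. coeff (theta a f * theta b g) u)"
  proof (rule sum.cong [OF refl], rule sum.mono_neutral_right)
    fix a
    show "\<forall>b\<in>{..?N} - {..?N - a}. coeff (theta a f * theta b g) u = 0"
    proof
      fix b assume "b \<in> {..?N} - {..?N - a}"
      then have "?N < a + b" by auto
      then show "coeff (theta a f * theta b g) u = 0"
        using order_ge_mult [OF order_ge_theta order_ge_theta] by (simp add: order_ge_def)
    qed
  qed auto
  also have "\<dots> = coeff (Theta (f * g)) u"
    by (subst sum_triangle_diagonal)
       (simp add: coeff_Theta [OF order_refl] coeff_sum theta_mult)
  finally show "coeff (Theta (f * g)) u = coeff (Theta f * Theta g) u" ..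
qed

lemma Theta_power: "Theta (f ^ k) = Theta f ^ k"
  by (induction k) (simp_all add: Theta_1 Theta_mult)

lemma Theta_1_minus_X: "Theta (1 - X) = (1 - (X + Y)) * geom Y"
proof -
  have "Theta (1 - X) = (1 - Y) * geom Y - X * geom Y"
    by (simp add: Theta_diff Theta_1 Theta_X geom_Y_left)
  then show ?thesis by (simp add: algebra_simps)
qed

lemma Theta_Y: "Theta Y = (1 - (X + Y)) * Y * geom Y"
proof -
  have "Theta Y = Theta (X + Y) - Theta X"
    by (simp add: Theta_diff [symmetric])
  also have "\<dots> = (X + Y) * ((1 - Y) * geom Y) - X * geom Y"
    by (simp add: Theta_XY Theta_X geom_Y_left)
  finally show ?thesis by (simp add: algebra_simps)
qed

lemma Y_geom_Y: "Y * geom Y = geom Y - 1" and geom_Y_Y: "geom Y * Y = geom Y - 1"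
  using geom_Y_left geom_Y_right by (simp_all add: algebra_simps)

text \<open>\<open>Theta\<close> sends \<open>geom X * Y\<close> to \<open>Y\<close>: the factor
  \<open>(1 - (X + Y)) * geom Y\<close> inside \<open>Theta Y\<close> equals
  \<open>Theta (1 - X)\<close> and cancels against \<open>Theta (geom X)\<close>.\<close>

lemma Theta_Y_1_minus_pY: "Theta (Y * (1 - geom X * Y)) = (1 - (X + Y)) * Y"
proof -
  let ?z = "1 - (X + Y)"
  have "Theta (geom X * Y) = Theta (geom X) * (?z * (geom Y * Y))"
    by (simp add: Theta_mult Theta_Y mult.assoc Y_geom_Y geom_Y_Y)
  also have "\<dots> = Theta (geom X * (1 - X)) * Y"
    by (simp add: Theta_mult Theta_1_minus_X mult.assoc)
  finally have "Theta (1 - geom X * Y) = 1 - Y"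
    by (simp add: Theta_diff Theta_1 geom_X_right)
  then show ?thesis
    by (simp add: Theta_mult Theta_Y mult.assoc geom_Y_right)
qed

section \<open>Membership in the completion\<close>

lemma coeff_X_mult: "coeff (X * f) u = (case u of Lx # v \<Rightarrow> coeff f v | _ \<Rightarrow> 0)"
proof (cases u)
  case (Cons a v)
  have "coeff (X * f) u = (\<Sum>i\<in>{1}. coeff X (take i u) * coeff f (drop i u))"
    unfolding times_ncs.rep_eq
    by (rule sum.mono_neutral_right) (auto simp: X_def Cons take_Cons split: nat.splits)
  then show ?thesis by (cases a) (simp_all add: Cons X_def)
qed (simp add: times_ncs.rep_eq X_def)

lemma hom_part_X_mult: "hom_part (Suc n) (X * f) = X * hom_part n f"
  by (rule ncs_eqI) (auto simp: coeff_X_mult split: list.splits letter.splits)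

lemma tau_hom_part: "tau (hom_part n f) = hom_part n (tau f)"
  by (rule ncs_eqI) simp

text \<open>Mirror image of \<open>hom_part_X_mult\<close> under \<open>tau\<close>.\<close>

lemma hom_part_mult_Y: "hom_part (Suc n) (f * Y) = hom_part n f * Y"
proof -
  have "tau (hom_part (Suc n) (f * Y)) = tau (hom_part n f * Y)"
    by (simp only: tau_hom_part tau_mult tau_Y hom_part_X_mult)
  then show ?thesis by (metis tau_tau)
qed

lemma X_mult_Y_in_completion_H0: "X * g * Y \<in> completion H0"
  unfolding completion_def mem_Collect_eq
proof
  fix n
  show "hom_part n (X * g * Y) \<in> H0"
  proof (cases "n < 2")
    case True
    have "order_ge (X * g * Y) (1 + 0 + 1)"
      by (intro order_ge_mult order_ge_X order_ge_Y order_ge_0)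
    with True have "hom_part n (X * g * Y) = smult 0 1 + X * 0 * Y"
      by (intro ncs_eqI) (auto simp: order_ge_def)
    then show ?thesis
      unfolding H0_def nc_poly_def
      by (intro CollectI exI [of _ "0::rat"] exI [of _ "0::ncs"]) simp
  next
    case False
    then obtain k where n: "n = Suc (Suc k)"
      by (metis add_2_eq_Suc le_Suc_ex not_less)
    have "hom_part k g \<in> nc_poly"
      using completion_nc_poly by (auto simp: completion_def)
    moreover have "hom_part n (X * g * Y) = smult 0 1 + X * hom_part k g * Y"
      by (simp add: n hom_part_X_mult hom_part_mult_Y mult.assoc)
    ultimately show ?thesis
      unfolding H0_def by blast
  qed
qed

section \<open>\<open>tau\<close> on powers and geometric series\<close>

lemma tau_power: "tau (f ^ k) = tau f ^ k"
  by (induction k) (simp_all add: tau_1 tau_mult power_commutes)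

lemma tau_geom: "tau (geom f) = geom (tau f)"
proof (rule ncs_eqI)
  show "coeff (tau (geom f)) u = coeff (geom (tau f)) u" for u
    by (simp add: geom_def coeff_nc_sum tau_power [symmetric])
qed

lemma power_mult_shift: "(a * b) ^ k * a = a * (b * a) ^ k" for a b :: "'a::monoid_mult"
  by (induction k) (simp_all add: mult.assoc)

lemma XgY_diff: "X * f * Y - X * g * Y = X * (f - g) * Y"
  by (simp add: algebra_simps)

section \<open>The two identities\<close>

lemma one_minus_X_geom_Y: "1 - X * geom Y = (1 - (X + Y)) * geom Y"
proof -
  have "1 - X * geom Y = (1 - Y) * geom Y - X * geom Y"
    by (simp add: geom_Y_left)
  then show ?thesis by (simp add: algebra_simps)
qed

text \<open>Use \<open>(1 - (X + Y)) * Y = (1 - Y) * Y - X * Y\<close> and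
  \<open>geom Y * (1 - Y) = 1\<close>. As a difference of consecutive terms, the value telescopes
  when summed over \<open>k\<close>.\<close>

lemma Theta_X_power_Y_1_minus_pY:
  "Theta (X ^ Suc k * Y * (1 - geom X * Y)) =
    (X * geom Y) ^ k * X * Y - (X * geom Y) ^ Suc k * X * Y"
proof -
  let ?c = "X * geom Y"
  have "?c ^ Suc k * (1 - Y) = ?c ^ k * X"
    by (simp only: power_Suc2 mult.assoc geom_Y_right mult_1_right)
  moreover have "Theta (X ^ Suc k * Y * (1 - geom X * Y)) = ?c ^ Suc k * ((1 - (X + Y)) * Y)"
    unfolding mult.assoc
    by (simp only: Theta_mult [of "X ^ Suc k"] Theta_power Theta_X Theta_Y_1_minus_pY)
  moreover have "?c ^ Suc k * ((1 - (X + Y)) * Y) = ?c ^ Suc k * (1 - Y) * Y - ?c ^ Suc k * X * Y"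
    by (simp add: algebra_simps)
  ultimately show ?thesis by simp
qed

text \<open>Once extended to \<open>i = 0\<close>, the sum on the right equals the
  \<open>tau\<close> term. The added summand \<open>W m\<close> is balanced by
  \<open>Theta a\<close> up to \<open>X ^ m * Y\<close>, and \<open>- a\<close> supplies the
  rest.\<close>

lemma geom_single_block_identity:
  assumes "m \<ge> 1"
  defines "lhs \<equiv> X ^ m * Y * geom X * Y - tau (X ^ m * Y * geom X * Y)"
    and "a \<equiv> X ^ m * Y * (1 - geom X * Y)"
  shows "lhs \<in> completion H0"
    and "lhs = (Theta a - a)
             - (\<Sum>i=1..m-1. theta i
                 (X ^ (m - i) * Y + (X * geom Y) ^ (m - i) * X * Y
                    - (X * geom Y) ^ (m - i - 1) * X * Y))"
proof -
  let ?z = "1 - (X + Y)" and ?c = "X * geom Y"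
  obtain k where m: "m = Suc k"
    using assms(1) by (cases m) auto
  have tau: "tau (X ^ m * Y * geom X * Y) = ?c * X * Y ^ m"
    by (simp add: tau_mult tau_power tau_geom tau_X tau_Y mult.assoc)
  have "lhs = X * (X ^ k * Y * geom X) * Y - X * (geom Y * X * Y ^ k) * Y"
    unfolding lhs_def tau by (simp add: m mult.assoc power_commutes)
  then show "lhs \<in> completion H0"
    by (simp only: XgY_diff X_mult_Y_in_completion_H0)
  define W where "W j = X ^ j * Y + ?c ^ j * X * Y - ?c ^ (j - 1) * X * Y" for j
  \<comment> \<open>The last two terms of \<open>W\<close> combine into \<open>1 - (X + Y)\<close>
    times a term covered by \<open>sum_theta_geom_Y_X_Y\<close>.\<close>
  have W: "W (Suc j) = X ^ Suc j * Y - ?z * ((geom Y * X) ^ Suc j * Y)" for j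
  proof -
    have "?z * ((geom Y * X) ^ Suc j * Y) = ?z * geom Y * (X * (geom Y * X) ^ j) * Y"
      by (simp add: mult.assoc)
    also have "\<dots> = (1 - ?c) * (?c ^ j * X) * Y"
      by (simp only: one_minus_X_geom_Y power_mult_shift)
    finally show ?thesis
      by (simp add: W_def algebra_simps)
  qed
  \<comment> \<open>\<open>1 - (X + Y)\<close> is fixed by \<open>theta_fps\<close>, so it passes
    through each \<open>theta i\<close>.\<close>
  have z: "theta i (?z * f) = ?z * theta i f" for i f
  proof -
    have "theta_fps (?z * f) = fps_const ?z * theta_fps f"
      by (simp only: theta_fps_mult theta_fps_diff theta_fps_1 theta_fps_XY
          fps_const_1_eq_1 [symmetric] fps_const_sub)
    then have "theta_fps (?z * f) $ i = (fps_const ?z * theta_fps f) $ i"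
      by simp
    then show ?thesis by simp
  qed
  have "(\<Sum>i<m. theta i (W (m - i))) =
      (\<Sum>i<m. theta i (X ^ (m - i) * Y) - ?z * theta i ((geom Y * X) ^ (m - i) * Y))"
  proof (intro sum.cong refl)
    fix i assume "i \<in> {..<m}"
    then obtain j where "m - i = Suc j"
      by (metis Suc_diff_Suc lessThan_iff)
    then show "theta i (W (m - i)) =
        theta i (X ^ (m - i) * Y) - ?z * theta i ((geom Y * X) ^ (m - i) * Y)"
      by (simp only: W theta_diff z)
  qed
  also have "\<dots> = X * Y ^ m - ?z * (geom Y * X * Y ^ m)"
    using assms(1)
    by (simp only: sum_subtractf sum_distrib_left [symmetric] sum_theta_X_Y sum_theta_geom_Y_X_Y)
  also have "\<dots> = X * Y ^ m - (1 - ?c) * X * Y ^ m"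
    by (simp only: one_minus_X_geom_Y mult.assoc)
  also have "\<dots> = ?c * X * Y ^ m"
    by (simp add: algebra_simps)
  also have "(\<Sum>i<m. theta i (W (m - i))) = W m + (\<Sum>i=1..m-1. theta i (W (m - i)))"
    by (simp add: m lessThan_Suc_atMost atMost_atLeast0 sum.atLeast_Suc_atMost theta_0)
  finally have sum_W: "(\<Sum>i=1..m-1. theta i (W (m - i))) = ?c * X * Y ^ m - W m"
    by (simp add: algebra_simps)
  have Theta_a: "Theta a = ?c ^ k * X * Y - ?c ^ m * X * Y"
    unfolding a_def m by (rule Theta_X_power_Y_1_minus_pY)
  have W_m: "W m = X ^ m * Y + ?c ^ m * X * Y - ?c ^ k * X * Y"
    by (simp add: W_def m)
  show "lhs = (Theta a - a)
             - (\<Sum>i=1..m-1. theta i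
                 (X ^ (m - i) * Y + (X * geom Y) ^ (m - i) * X * Y
                    - (X * geom Y) ^ (m - i - 1) * X * Y))"
    unfolding W_def [symmetric] lhs_def tau sum_W Theta_a W_m
    by (simp add: a_def algebra_simps)
qed

text \<open>\<open>Theta (b N)\<close> telescopes to \<open>X * Y\<close> minus the
  \<open>tau\<close> term. The sum extended to \<open>l = 0\<close> is
  \<open>X * Y * (1 - (geom X * Y) ^ N)\<close>, its added summand being \<open>b N\<close>; in the
  difference \<open>X * Y\<close> and \<open>b N\<close> cancel.\<close>

lemma geom_block_power_identity:
  assumes "n \<ge> 1"
  defines "lhs \<equiv> X * Y * (geom X * Y) ^ (n - 1) - tau (X * Y * (geom X * Y) ^ (n - 1))"
    and "b \<equiv> (\<lambda>k. (\<Sum>j=1..k. X ^ j) * Y * (1 - geom X * Y))"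
  shows "lhs \<in> completion H0"
    and "lhs = (Theta (b (n - 1)) - b (n - 1)) - (\<Sum>l=1..n-2. theta l (b (n - l - 1)))"
proof -
  let ?c = "X * geom Y" and ?h = "1 - geom X * Y"
  obtain N where n: "n = Suc N"
    using assms(1) by (cases n) auto
  have tau: "tau (X * Y * (geom X * Y) ^ N) = ?c ^ N * X * Y"
    by (simp add: tau_mult tau_power tau_geom tau_X tau_Y mult.assoc)
  then have lhs: "lhs = X * Y * (geom X * Y) ^ N - ?c ^ N * X * Y"
    by (simp add: lhs_def n)
  have "\<exists>g. lhs = X * g * Y"
  proof (cases N)
    case 0
    then have "lhs = X * 0 * Y" by (simp add: lhs)
    then show ?thesis ..
  next
    case (Suc k)
    have "lhs = X * (Y * (geom X * Y) ^ k * geom X) * Y - X * (geom Y * ?c ^ k * X) * Y"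
      unfolding lhs Suc power_Suc2 [of "geom X * Y"] power_Suc [of ?c] by (simp only: mult.assoc)
    then show ?thesis unfolding XgY_diff ..
  qed
  then show "lhs \<in> completion H0"
    using X_mult_Y_in_completion_H0 by auto
  have b_0: "b 0 = 0" and b_Suc: "b (Suc k) = b k + X ^ Suc k * (Y * ?h)" for k
    by (simp_all add: b_def distrib_right mult.assoc)
  have Theta_b: "Theta (b k) = X * Y - ?c ^ k * X * Y" for k
  proof (induction k)
    case 0
    show ?case using Theta_diff [of 0 0] by (simp add: b_0)
  next
    case (Suc k)
    then show ?case
      by (simp add: b_Suc Theta_add Theta_X_power_Y_1_minus_pY mult.assoc [symmetric]
          del: power_Suc)
  qed
  \<comment> \<open>Each \<open>b\<close> gains one power of \<open>X\<close> from \<open>k\<close>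
    to \<open>Suc k\<close>; the new summand \<open>l = k\<close> of the old part is
    \<open>theta k (b 0) = 0\<close>.\<close>
  have theta_b: "(\<Sum>l<k. theta l (b (k - l))) = X * Y * (1 - (geom X * Y) ^ k)" for k
  proof (induction k)
    case (Suc k)
    have "(\<Sum>l<Suc k. theta l (b (Suc k - l))) =
        (\<Sum>l<Suc k. theta l (b (k - l)) + theta l (X ^ (Suc k - l) * (Y * ?h)))"
      by (intro sum.cong refl) (simp only: lessThan_iff less_Suc_eq_le Suc_diff_le b_Suc theta_add)
    also have "\<dots> = X * Y * (1 - (geom X * Y) ^ k) + X * Y * (geom X * Y) ^ k * ?h"
      by (simp only: sum.distrib sum_theta_X_Y_1_minus_pY)
         (simp add: Suc.IH b_0)
    finally show ?case
      by (simp only: power_Suc2) (simp add: algebra_simps)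
  qed simp
  have "(\<Sum>l<N. theta l (b (N - l))) = b N + (\<Sum>l=1..N-1. theta l (b (N - l)))"
  proof (cases N)
    case (Suc k)
    then show ?thesis
      by (simp add: lessThan_Suc_atMost atMost_atLeast0 sum.atLeast_Suc_atMost theta_0
          del: sum.lessThan_Suc)
  qed (simp add: b_0)
  then have "(\<Sum>l=1..N-1. theta l (b (N - l))) = X * Y * (1 - (geom X * Y) ^ N) - b N"
    by (simp only: theta_b add_diff_cancel_left')
  then show "lhs = (Theta (b (n - 1)) - b (n - 1)) - (\<Sum>l=1..n-2. theta l (b (n - l - 1)))"
    by (simp add: lhs Theta_b n algebra_simps)
qed

theorem theorem1:
  shows "(\<forall>m::nat. m \<ge> 1 \<longrightarrow>
      (let lhs = X ^ m * Y * geom X * Y - tau (X ^ m * Y * geom X * Y);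
           a = X ^ m * Y * (1 - geom X * Y);
           rhs = (Theta a - a)
             - (\<Sum>i=1..m-1. theta i
                 (X ^ (m - i) * Y + (X * geom Y) ^ (m - i) * X * Y
                    - (X * geom Y) ^ (m - i - 1) * X * Y))
       in lhs \<in> completion H0 \<and> rhs \<in> completion H0 \<and> lhs = rhs))
   \<and> (\<forall>n::nat. n \<ge> 1 \<longrightarrow>
      (let lhs = X * Y * (geom X * Y) ^ (n - 1) - tau (X * Y * (geom X * Y) ^ (n - 1));
           b = (\<lambda>k. (\<Sum>j=1..k. X ^ j) * Y * (1 - geom X * Y));
           rhs = (Theta (b (n - 1)) - b (n - 1)) - (\<Sum>l=1..n-2. theta l (b (n - l - 1)))
       in lhs \<in> completion H0 \<and> rhs \<in> completion H0 \<and> lhs = rhs))"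
proof -
  \<comment> \<open>Membership of the right-hand side is inherited from the left through the
    equality.\<close>
  have eq: "l \<in> S \<and> r \<in> S \<and> l = r" if "l \<in> S" "l = r" for l r :: ncs and S
    using that by simp
  show ?thesis
    unfolding Let_def
    by (rule conjI; intro allI impI; rule eq;
        (rule geom_single_block_identity | rule geom_block_power_identity); assumption)
qed

end
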